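(* No compactly finite-dimensional topological group contains a closed subspace homeomorphic to the hedgehog $H_\omega$.
   Context: Topological groups are assumed Hausdorff. $\dim$ denotes the covering dimension. A topological group $G$ is called compactly finite-dimensional if $\sup\{\dim(K): K \text{ is a compact subspace of } G\}$ is finite. The hedgehog is the subspace $H_\omega=\bigcup_{n\in\omega}[0,1]\cdot\vec e_n\subset l_2$ of the Hilbert space $l_2$ (with the norm topology), where $(\vec e_n)_{n\in\omega}$ is the standard orthonormal basis of $l_2$ and $[0,1]\cdot\vec e_n=\{t\vec e_n: t\in[0,1]\}$. *)

theory Defs
  imports "HOL-Analysis.Analysis"
begin

section \<open>Covering dimension\<close>

definition covering_dim_le :: "'a topology \<Rightarrow> int \<Rightarrow> bool" where
  "covering_dim_le X n \<longleftrightarrow> -1 \<le> n \<and>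
     (\<forall>\<U>. finite \<U> \<and> (\<forall>U\<in>\<U>. openin X U) \<and> \<Union>\<U> = topspace X \<longrightarrow>
       (\<exists>\<V>. finite \<V> \<and> (\<forall>V\<in>\<V>. openin X V) \<and> \<Union>\<V> = topspace X \<and>
            (\<forall>V\<in>\<V>. \<exists>U\<in>\<U>. V \<subseteq> U) \<and>
            (\<forall>x\<in>topspace X. int (card {V \<in> \<V>. x \<in> V}) \<le> n + 1)))"

text \<open>The value is \<open>-1\<close> for the empty space and \<open>\<infinity>\<close> (the infimum of the empty set) if no
  integer bound holds.\<close>

definition covering_dim :: "'a topology \<Rightarrow> ereal" where
  "covering_dim X = Inf {ereal (of_int n) |n. covering_dim_le X n}"

text \<open>The supremum is never \<open>-\<infinity>\<close>, as the empty set is compact, so \<open>< \<infinity>\<close> means finite.\<close>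

definition compactly_finite_dimensional :: "'a topology \<Rightarrow> bool" where
  "compactly_finite_dimensional X \<longleftrightarrow>
     (SUP K \<in> {K. compactin X K}. covering_dim (subtopology X K)) < \<infinity>"

section \<open>The Hilbert space of square-summable sequences and the hedgehog\<close>

definition l2 :: "(nat \<Rightarrow> real) set" where
  "l2 = {x. (\<lambda>n. (x n)\<^sup>2) summable_on UNIV}"

definition l2_norm :: "(nat \<Rightarrow> real) \<Rightarrow> real" where
  "l2_norm x = sqrt (\<Sum>\<^sub>\<infinity>n. (x n)\<^sup>2)"

definition l2_dist :: "(nat \<Rightarrow> real) \<Rightarrow> (nat \<Rightarrow> real) \<Rightarrow> real" where
  "l2_dist x y = l2_norm (\<lambda>n. x n - y n)"

lemma l2_norm_nonneg: "0 \<le> l2_norm x"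
  unfolding l2_norm_def by (simp add: infsum_nonneg)

lemma L2_set_le_l2_norm:
  assumes "x \<in> l2" "finite F"
  shows "L2_set x F \<le> l2_norm x"
  unfolding L2_set_def l2_norm_def
  using assms by (auto simp: l2_def intro!: finite_sum_le_infsum)

lemma
  assumes x: "x \<in> l2" and y: "y \<in> l2"
  shows l2_add: "(\<lambda>n. x n + y n) \<in> l2"
    and l2_norm_triangle: "l2_norm (\<lambda>n. x n + y n) \<le> l2_norm x + l2_norm y"
proof -
  have bound: "(\<Sum>n\<in>F. (x n + y n)\<^sup>2) \<le> (l2_norm x + l2_norm y)\<^sup>2" if "finite F" for F
  proof -
    have "L2_set (\<lambda>n. x n + y n) F \<le> L2_set x F + L2_set y F"
      by (rule L2_set_triangle_ineq)
    also have "\<dots> \<le> l2_norm x + l2_norm y"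
      using L2_set_le_l2_norm[OF x that] L2_set_le_l2_norm[OF y that] by simp
    finally show ?thesis
      unfolding L2_set_def by (rule sqrt_le_D)
  qed
  have s: "(\<lambda>n. (x n + y n)\<^sup>2) summable_on UNIV"
    by (rule nonneg_bdd_above_summable_on) (auto intro!: bdd_aboveI2 bound)
  then show "(\<lambda>n. x n + y n) \<in> l2"
    by (simp add: l2_def)
  have "(\<Sum>\<^sub>\<infinity>n. (x n + y n)\<^sup>2) \<le> (l2_norm x + l2_norm y)\<^sup>2"
    using s by (rule infsum_le_finite_sums) (rule bound)
  then show "l2_norm (\<lambda>n. x n + y n) \<le> l2_norm x + l2_norm y"
    unfolding l2_norm_def[of "\<lambda>n. x n + y n"]
    by (rule real_le_lsqrt[rotated]) (simp add: l2_norm_nonneg)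
qed

lemma l2_diff: "x \<in> l2 \<Longrightarrow> y \<in> l2 \<Longrightarrow> (\<lambda>n. x n - y n) \<in> l2"
  using l2_add[of x "\<lambda>n. - y n"] by (simp add: l2_def)

lemma l2_norm_eq_0: 
  assumes "x \<in> l2"
  shows "l2_norm x = 0 \<longleftrightarrow> (\<forall>n. x n = 0)"
proof
  assume "l2_norm x = 0"
  then have "L2_set x {n} \<le> 0" for n
    using L2_set_le_l2_norm[OF assms, of "{n}"] by simp
  then show "\<forall>n. x n = 0"
    by (simp add: L2_set_def)
qed (simp add: l2_norm_def)

interpretation l2: Metric_space l2 l2_dist
proof
  fix x y z
  show "0 \<le> l2_dist x y"
    by (simp add: l2_dist_def l2_norm_nonneg)
  show "l2_dist x y = l2_dist y x"
    by (simp add: l2_dist_def l2_norm_def power2_commute)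
  assume x: "x \<in> l2" and y: "y \<in> l2"
  show "l2_dist x y = 0 \<longleftrightarrow> x = y"
    using l2_norm_eq_0[OF l2_diff[OF x y]] by (auto simp: l2_dist_def)
  assume z: "z \<in> l2"
  show "l2_dist x z \<le> l2_dist x y + l2_dist y z"
    using l2_norm_triangle[OF l2_diff[OF x y] l2_diff[OF y z]] by (simp add: l2_dist_def)
qed

definition unit_seq :: "nat \<Rightarrow> nat \<Rightarrow> real" where
  "unit_seq n = (\<lambda>k. if k = n then 1 else 0)"

definition hedgehog_set :: "(nat \<Rightarrow> real) set" where
  "hedgehog_set = (\<Union>n. {(\<lambda>k. t * unit_seq n k) |t. t \<in> {0..1}})"

lemma hedgehog_set_subset_l2: "hedgehog_set \<subseteq> l2"
proof
  fix x assume "x \<in> hedgehog_set"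
  then obtain n t where x: "x = (\<lambda>k. t * unit_seq n k)"
    by (auto simp: hedgehog_set_def)
  have "(\<lambda>k. (x k)\<^sup>2) summable_on UNIV \<longleftrightarrow> (\<lambda>k. (x k)\<^sup>2) summable_on {n}"
    by (rule summable_on_cong_neutral) (auto simp: x unit_seq_def)
  then show "x \<in> l2"
    by (simp add: l2_def)
qed

definition hedgehog :: "(nat \<Rightarrow> real) topology" where
  "hedgehog = subtopology l2.mtopology hedgehog_set"

end

theory Submission
  imports Defs
begin

text \<open>Suppose \<open>G\<close> contains a closed hedgehog. After translation its centre is \<open>0\<close>, and then
  initial parts of the spikes are arcs inside any given neighbourhood \<open>U\<close> of \<open>0\<close>, whose end points
  eventually leave any given compact set. Inductively this gives maps \<open>f\<close> of cubes into \<open>G\<close> with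
  \<open>f(x, t) = f(x) + g(t)\<close>, \<open>g\<close> being such an arc, under which opposite faces have disjoint images:
  smallness of \<open>g\<close> keeps the old pairs of faces apart, and the end point of \<open>g\<close> avoiding the compact
  set \<open>-K + K\<close>, where \<open>K\<close> is the previous image, separates the new pair. By Lebesgue's covering
  theorem the images of these cubes have arbitrarily large dimension.\<close>

section \<open>Lebesgue's covering theorem\<close>

text \<open>One Hilbert cube serves every dimension, so an induction on \<open>n\<close> stays
  within one type; statements about dimension \<open>n\<close> constrain only the coordinates below
  \<open>n\<close>.\<close>

definition cube :: "(nat \<Rightarrow> real) set" where
  "cube = {x. \<forall>i. x i \<in> {0..1}}"

lemma compact_cube: "compact cube"
proof -
  have "cube = PiE UNIV (\<lambda>_. {0..1})"
    by (auto simp: cube_def PiE_def)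
  moreover have "compactin (product_topology (\<lambda>_::nat. euclidean) UNIV) (PiE UNIV (\<lambda>_. {0..1::real}))"
    unfolding compactin_PiE by auto
  ultimately show ?thesis
    by (simp add: euclidean_product_topology)
qed

text \<open>The product metric weights the coordinate distances, truncated at 1, by the powers of
  1/2, whose sum is 2.\<close>

lemma dist_fun_le_if_coordinates:
  fixes x y :: "nat \<Rightarrow> real"
  assumes "\<And>i. dist (x i) (y i) \<le> e"
  shows "dist x y \<le> 2 * e"
proof -
  have "dist x y \<le> (\<Sum>n. (1/2)^n * e)"
    unfolding dist_fun_def
  proof (rule suminf_le)
    show "summable (\<lambda>n. (1/2)^n * min (dist (x (from_nat n)) (y (from_nat n))) 1)"
      by (rule summable_comparison_test'[of "\<lambda>n. (1/2)^n"]) (auto simp: summable_geometric_iff)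
    show "summable (\<lambda>n. (1/2)^n * e)"
      by (intro summable_mult2) (simp add: summable_geometric_iff)
  qed (use assms in \<open>auto simp: min_le_iff_disj\<close>)
  also have "\<dots> = (\<Sum>n. (1/2)^n) * e"
    by (rule suminf_mult2[symmetric]) (simp add: summable_geometric_iff)
  also have "\<dots> = 2 * e"
    using suminf_geometric[of "1/2::real"] by simp
  finally show ?thesis .
qed

text \<open>Assign to each grid point a set of the cover containing the ball around it of radius a Lebesgue
  number, and label the point by the faces this set meets. All the sets assigned to the vertices of a
  small Kuhn simplex contain each of its vertices, and those of a completely labelled simplex are
  \<open>n + 1\<close> different sets.\<close>

lemma Lebesgue_covering_cube:
  fixes V :: "'b \<Rightarrow> (nat \<Rightarrow> real) set"
  assumes fin: "finite I"
    and op: "\<And>i. i \<in> I \<Longrightarrow> openin (top_of_set cube) (V i)"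
    and cover: "cube \<subseteq> (\<Union>i\<in>I. V i)"
    and faces: "\<And>i j x y. i \<in> I \<Longrightarrow> j < n \<Longrightarrow> x \<in> V i \<Longrightarrow> y \<in> V i \<Longrightarrow> x j = 0 \<Longrightarrow> y j = 1 \<Longrightarrow> False"
  shows "\<exists>x\<in>cube. n < card {i \<in> I. x \<in> V i}"
proof -
  have "\<forall>i\<in>I. \<exists>T. open T \<and> V i = cube \<inter> T"
    using op by (simp add: openin_open)
  then obtain T where T: "\<And>i. i \<in> I \<Longrightarrow> open (T i)" "\<And>i. i \<in> I \<Longrightarrow> V i = cube \<inter> T i"
    by metis
  obtain d where d: "0 < d" "\<And>x. x \<in> cube \<Longrightarrow> \<exists>G\<in>T ` I. ball x d \<subseteq> G"
    using Heine_Borel_lemma[OF compact_cube, of "T ` I"] T cover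
    by (smt (verit) UN_iff image_iff Int_iff subset_eq)
  then have "\<forall>x\<in>cube. \<exists>i\<in>I. ball x d \<subseteq> T i"
    by auto
  then obtain c where c: "\<And>x. x \<in> cube \<Longrightarrow> c x \<in> I" "\<And>x. x \<in> cube \<Longrightarrow> ball x d \<subseteq> T (c x)"
    by metis
  \<comment> \<open>Grid points that differ by at most one step of size \<open>1 / real p\<close> in
    every coordinate are then closer than the Lebesgue number \<open>d\<close>; the factor 2 comes
    from the product metric.\<close>
  obtain p :: nat where p: "0 < p" "2 * (1 / real p) < d"
  proof -
    obtain p where "0 < p" "inverse (real p) < d / 2"
      using ex_inverse_of_nat_less[of "d/2"] d(1) by auto
    then show ?thesis by (intro that[of p]) (auto simp: field_simps)
  qed
  define pt where "pt q = (\<lambda>i. real (q i) / real p)" for q :: "nat \<Rightarrow> nat"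
  have pt: "pt q \<in> cube" if "\<forall>j. q j \<le> p" for q :: "nat \<Rightarrow> nat"
    using that p(1) by (auto simp: pt_def cube_def)
  \<comment> \<open>The label depends on the assigned set alone. The value 1 is also the default for
    sets meeting neither face; by \<open>faces\<close>, every set that meets the face
    \<open>x j = 1\<close> receives it, as Kuhn's lemma requires.\<close>
  define face_lab where "face_lab i = (\<lambda>j. if \<exists>x\<in>V i. x j = 0 then 0 else 1::nat)" for i
  define lab where "lab q = face_lab (c (pt q))" for q
  have mem: "pt q \<in> V (c (pt q))" if "\<forall>j. q j \<le> p" for q :: "nat \<Rightarrow> nat"
    using T(2)[OF c(1)[OF pt[OF that]]] c(2)[OF pt[OF that]] pt[OF that] d(1) by auto
  have "odd (card {s. ksimplex p n s \<and> (reduced n \<circ> lab) ` s = {..n}})"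
  proof (rule kuhn_combinatorial[OF p(1)]; intro allI impI; elim conjE)
    fix q :: "nat \<Rightarrow> nat" and j assume q: "\<forall>j. q j \<le> p" "j < n"
    { assume "q j = 0"
      then have "pt q j = 0" by (simp add: pt_def)
      then show "lab q j = 0" using mem[OF q(1)] by (auto simp: lab_def face_lab_def) }
    { assume "q j = p"
      then have "pt q j = 1" using p(1) by (simp add: pt_def)
      then show "lab q j = 1"
        using faces[OF c(1)[OF pt[OF q(1)]] q(2) _ mem[OF q(1)]] by (auto simp: lab_def face_lab_def) }
  qed
  then have "{s. ksimplex p n s \<and> (reduced n \<circ> lab) ` s = {..n}} \<noteq> {}"
    by (metis card.empty even_zero)
  then obtain s where s: "ksimplex p n s" "(reduced n \<circ> lab) ` s = {..n}"
    by blast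
  from s(1) obtain base upd where "kuhn_simplex p n base upd s"
    by (auto elim: ksimplex.cases)
  then interpret kuhn_simplex p n base upd s .
  \<comment> \<open>Each vertex raises a coordinate of \<open>base\<close> by at most one; the
    coordinates from \<open>n\<close> on equal \<open>p\<close> at all vertices, so
    \<open>pt\<close> is 1 there.\<close>
  have range: "base j \<le> q j \<and> q j \<le> Suc (base j) \<and> q j \<le> p" if "q \<in> s" for q j
    using that s_space out_eq_p[OF that] base_out[of j] base
    by (cases "j < n") (auto simp: s_eq enum_def Pi_iff Suc_le_eq less_imp_le)
  have fin_s: "finite s"
    by (simp add: s_eq)
  obtain q0 where q0: "q0 \<in> s"
    using s(2) by auto
  have "pt q0 \<in> V i" if "i \<in> (c \<circ> pt) ` s" for i
  proof -
    from that obtain q where q: "q \<in> s" "i = c (pt q)" by auto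
    have qc: "pt q \<in> cube" "pt q0 \<in> cube"
      using pt range q(1) q0 by auto
    have "dist (pt q j) (pt q0 j) \<le> 1 / real p" for j
    proof -
      have "\<bar>real (q j) - real (q0 j)\<bar> \<le> 1"
        using range[OF q(1), of j] range[OF q0, of j] by linarith
      then show ?thesis
        using p(1) by (simp add: pt_def dist_real_def divide_right_mono flip: diff_divide_distrib)
    qed
    then have "dist (pt q) (pt q0) < d"
      using dist_fun_le_if_coordinates[of "pt q" "pt q0" "1 / real p"] p(2) by fastforce
    then show ?thesis
      using c[OF qc(1)] T(2) qc q by auto
  qed
  then have sub: "(c \<circ> pt) ` s \<subseteq> {i \<in> I. pt q0 \<in> V i}"
    using c(1) pt range by auto
  \<comment> \<open>The reduced labels factor through the assigned sets, so \<open>n + 1\<close>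
    labels need at least \<open>n + 1\<close> sets.\<close>
  have "{..n} = (reduced n \<circ> face_lab) ` (c \<circ> pt) ` s"
    using s(2) by (simp add: image_image lab_def o_def)
  then have "Suc n \<le> card ((c \<circ> pt) ` s)"
    by (metis card_atMost card_image_le fin_s finite_imageI)
  also have "\<dots> \<le> card {i \<in> I. pt q0 \<in> V i}"
    using sub fin by (intro card_mono) auto
  finally show ?thesis
    using pt range q0 by (intro bexI[of _ "pt q0"]) auto
qed

section \<open>Dimension of continuous images of the cube\<close>

text \<open>A substitute for injectivity that already forces the image of a continuous map into a
  Hausdorff space to have covering dimension at least \<open>n\<close>.\<close>

definition separates_faces :: "nat \<Rightarrow> ((nat \<Rightarrow> real) \<Rightarrow> 'a) \<Rightarrow> bool" where
  "separates_faces n f \<longleftrightarrow>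
     (\<forall>i<n. \<forall>x\<in>cube. \<forall>y\<in>cube. x i = 0 \<longrightarrow> y i = 1 \<longrightarrow> f x \<noteq> f y)"

lemma compact_cube_face: "compact {x \<in> cube. x i = a}"
proof -
  have "closed {x :: nat \<Rightarrow> real. x i = a}"
    by (intro closed_Collect_eq continuous_on_product_coordinates continuous_on_const)
  moreover have "{x \<in> cube. x i = a} = cube \<inter> {x. x i = a}"
    by auto
  ultimately show ?thesis
    using compact_cube by (simp add: compact_Int_closed)
qed

text \<open>Cover the image by open cells, each avoiding the image of one face from every opposite
  pair. A refinement pulled back to the cube has no member meeting two opposite faces, so by
  Lebesgue's theorem some point lies in at least \<open>n + 1\<close> members, while the dimension
  bound allows at most \<open>m + 1\<close>.\<close>

lemma covering_dim_le_cube_image: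
  fixes f :: "(nat \<Rightarrow> real) \<Rightarrow> 'a :: t2_space"
  assumes cont: "continuous_on cube f"
    and sep: "separates_faces n f"
    and dim: "covering_dim_le (top_of_set (f ` cube)) m"
  shows "int n \<le> m"
proof -
  let ?K = "f ` cube"
  define F where "F a i = f ` {x \<in> cube. x i = a}" for a i
  have F: "closed (F a i)" for a i
    unfolding F_def by (intro compact_imp_closed compact_continuous_image compact_cube_face
        continuous_on_subset[OF cont]) auto
  define cell where "cell T = ?K - (\<Union>i<n. F (if i \<in> T then 0 else 1) i)" for T
  have cell_open: "openin (top_of_set ?K) U" if U: "U \<in> cell ` Pow {..<n}" for U
  proof -
    obtain T where T: "U = cell T" using U by auto
    have "U = ?K \<inter> - (\<Union>i<n. F (if i \<in> T then 0 else 1) i)"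
      unfolding T cell_def by (rule Diff_eq)
    moreover have "closed (\<Union>i<n. F (if i \<in> T then 0 else 1) i)"
      by (intro closed_UN finite_lessThan ballI F)
    ultimately show ?thesis
      unfolding openin_open
      by (intro exI[of _ "- (\<Union>i<n. F (if i \<in> T then 0 else 1) i)"])
        (simp add: open_Compl del: Compl_UN)
  qed
  have cell_cover: "\<Union> (cell ` Pow {..<n}) = topspace (top_of_set ?K)"
  proof -
    have "z \<in> \<Union> (cell ` Pow {..<n})" if z: "z \<in> ?K" for z
    proof -
      have "z \<notin> F 0 i \<or> z \<notin> F 1 i" if "i < n" for i
      proof (rule ccontr)
        assume "\<not> ?thesis"
        then obtain x y where "x \<in> cube" "x i = 0" "y \<in> cube" "y i = 1" "f x = f y"
          by (auto simp: F_def)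
        then show False
          using sep that by (auto simp: separates_faces_def)
      qed
      \<comment> \<open>For the remaining directions \<open>z\<close> lies in the image of the
        0-face, hence not in that of the 1-face.\<close>
      then have "z \<in> cell {i. i < n \<and> z \<notin> F 0 i}"
        using z by (auto simp: cell_def)
      then show ?thesis by (rule UnionI[rotated]) auto
    qed
    moreover have "cell T \<subseteq> ?K" for T
      by (auto simp: cell_def)
    ultimately show ?thesis
      unfolding topspace_euclidean_subtopology by blast
  qed
  have "finite (cell ` Pow {..<n})"
    by simp
  then have "finite (cell ` Pow {..<n}) \<and> (\<forall>U\<in>cell ` Pow {..<n}. openin (top_of_set ?K) U) \<and>
      \<Union> (cell ` Pow {..<n}) = topspace (top_of_set ?K)"
    using cell_open cell_cover by blast
  from dim[unfolded covering_dim_le_def, THEN conjunct2, THEN spec, THEN mp, OF this]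
  obtain \<V> where \<V>: "finite \<V>" "\<forall>V\<in>\<V>. openin (top_of_set ?K) V" "\<Union>\<V> = topspace (top_of_set ?K)"
      "\<forall>V\<in>\<V>. \<exists>U\<in>cell ` Pow {..<n}. V \<subseteq> U"
      "\<forall>z\<in>topspace (top_of_set ?K). int (card {V \<in> \<V>. z \<in> V}) \<le> m + 1"
    by (elim exE conjE)
  have "\<exists>x\<in>cube. n < card {V \<in> \<V>. x \<in> cube \<inter> f -` V}"
  proof (rule Lebesgue_covering_cube[OF \<V>(1)])
    show "openin (top_of_set cube) (cube \<inter> f -` V)" if "V \<in> \<V>" for V
      using continuous_openin_preimage[OF cont _ bspec[OF \<V>(2) that]] by auto
    show "cube \<subseteq> (\<Union>V\<in>\<V>. cube \<inter> f -` V)"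
    proof
      fix x assume "x \<in> cube"
      moreover from this have "f x \<in> \<Union>\<V>"
        by (simp add: \<V>(3))
      ultimately show "x \<in> (\<Union>V\<in>\<V>. cube \<inter> f -` V)"
        by blast
    qed
    show False if V: "V \<in> \<V>" and j: "j < n" and x: "x \<in> cube \<inter> f -` V" and y: "y \<in> cube \<inter> f -` V"
      and xy: "x j = 0" "y j = 1" for V j x y
    proof -
      obtain T where T: "V \<subseteq> cell T" using \<V>(4) V by blast
      have "f x \<in> F 0 j" "f y \<in> F 1 j"
        using x y xy by (auto simp: F_def)
      moreover have "f x \<in> cell T" "f y \<in> cell T"
        using T x y by auto
      ultimately show False
        using j by (auto simp: cell_def split: if_splits)
    qed
  qed
  then obtain x where x: "x \<in> cube" "n < card {V \<in> \<V>. f x \<in> V}"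
    by auto
  then show ?thesis
    using bspec[OF \<V>(5), of "f x"] by auto
qed

section \<open>Arcs in topological groups\<close>

text \<open>Isolates what the construction of cubes takes from the hedgehog.\<close>

definition has_escaping_arcs :: "'a::topological_group_add itself \<Rightarrow> bool" where
  "has_escaping_arcs _ \<longleftrightarrow> (\<forall>U K. open U \<longrightarrow> (0::'a) \<in> U \<longrightarrow> compact K \<longrightarrow>
     (\<exists>g. continuous_on {0..1::real} g \<and> g 0 = 0 \<and> g ` {0..1} \<subseteq> U \<and> g 1 \<notin> K))"

lemma compact_left_differences:
  fixes A B :: "'a::topological_group_add set"
  assumes "compact A" "compact B"
  shows "compact ((\<lambda>(a, b). - b + a) ` (A \<times> B))"
  using assms
  by (intro compact_continuous_image compact_Times) (auto simp: case_prod_unfold intro!: continuous_intros)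

text \<open>The group may be noncommutative. Adding the arc on the right turns
  \<open>h x = h y\<close> into \<open>- f y + f x = g (y n) - g (x n)\<close>, so the sets to be
  avoided consist of left differences of values of \<open>f\<close>.\<close>

lemma escaping_arcs_imp_separated_cubes:
  assumes arcs: "has_escaping_arcs TYPE('a::{topological_group_add, t2_space})"
  shows "\<exists>f :: (nat \<Rightarrow> real) \<Rightarrow> 'a. continuous_on cube f \<and> separates_faces n f"
proof (induction n)
  case 0
  show ?case
    by (intro exI[of _ "\<lambda>_. 0"]) (auto simp: separates_faces_def)
next
  case (Suc n)
  then obtain f :: "(nat \<Rightarrow> real) \<Rightarrow> 'a" where cont: "continuous_on cube f" and sep: "separates_faces n f"
    by blast
  define F where "F a i = f ` {x \<in> cube. x i = a}" for a i
  have F: "compact (F a i)" for a i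
    unfolding F_def by (intro compact_continuous_image compact_cube_face
        continuous_on_subset[OF cont]) auto
  \<comment> \<open>These are the left differences over the old pairs of opposite faces. By
    induction 0 is not among them, and \<open>M\<close> is closed, so differences of elements close
    to 0 avoid \<open>M\<close>.\<close>
  define M where "M = (\<Union>i<n. (\<lambda>(a, b). - b + a) ` (F 0 i \<times> F 1 i))"
  have "compact M"
    unfolding M_def by (intro compact_UN compact_left_differences F) auto
  then have "open ((\<lambda>p. fst p - snd p) -` (- M))"
    by (intro open_vimage) (auto simp: compact_imp_closed open_Compl intro!: continuous_intros)
  moreover have "(0::'a) \<notin> M"
    using sep unfolding M_def F_def separates_faces_def
    by (auto simp: neg_eq_iff_add_eq_0[symmetric]) metis
  ultimately obtain A B where AB: "open A" "open B" "0 \<in> A" "0 \<in> B"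
      "A \<times> B \<subseteq> (\<lambda>p. fst p - snd p) -` (- M)"
    by (elim open_prod_elim[where x="(0,0)"]) auto
  \<comment> \<open>For the new pair of faces the right-hand side is \<open>g 1 - g 0 = g 1\<close>,
    so it suffices that \<open>g 1\<close> avoids all left differences of the image.\<close>
  define K where "K = (\<lambda>(a, b). - b + a) ` (f ` cube \<times> f ` cube)"
  have "compact K"
    unfolding K_def by (intro compact_left_differences compact_continuous_image cont compact_cube)
  then obtain g where g: "continuous_on {0..1::real} g" "g 0 = 0" "g ` {0..1} \<subseteq> A \<inter> B" "g 1 \<notin> K"
    using arcs AB unfolding has_escaping_arcs_def by (meson IntI open_Int)
  define h where "h x = f x + g (x n)" for x
  have "continuous_on cube h"
    unfolding h_def
    by (intro continuous_on_add cont continuous_on_compose2[OF g(1)]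
        continuous_on_subset[OF continuous_on_product_coordinates]) (auto simp: cube_def)
  moreover have "h x \<noteq> h y" if i: "i < Suc n" and xy: "x \<in> cube" "y \<in> cube" "x i = 0" "y i = 1" for i x y
  proof
    assume "h x = h y"
    then have "f x + g (x n) = f y + g (y n)"
      by (simp add: h_def)
    then have eq: "- f y + f x = g (y n) - g (x n)"
      by (metis add.assoc add_diff_cancel minus_add_cancel)
    show False
    proof (cases "i = n")
      case True
      then have "- f y + f x = g 1"
        using eq xy g(2) by simp
      then have "g 1 \<in> K"
        unfolding K_def using xy by (force intro!: image_eqI[of _ _ "(f x, f y)"])
      with g(4) show False ..
    next
      case False
      then have "- f y + f x \<in> M"
        using i xy unfolding M_def F_def
        by (auto intro!: bexI[of _ i] image_eqI[of _ _ "(f x, f y)"])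
      moreover have "g (y n) \<in> A" "g (x n) \<in> B"
        using g(3) xy by (auto simp: cube_def)
      then have "g (y n) - g (x n) \<notin> M"
        using AB(5) by (auto simp: subset_eq)
      ultimately show False
        using eq by simp
    qed
  qed
  ultimately show ?case
    unfolding separates_faces_def by blast
qed

section \<open>Compact subsets of the hedgehog\<close>

text \<open>All spikes start at the zero sequence \<open>spike n 0\<close>; this common centre is
  written \<open>spike 0 0\<close> below.\<close>

abbreviation spike :: "nat \<Rightarrow> real \<Rightarrow> nat \<Rightarrow> real" where
  "spike n t \<equiv> (\<lambda>k. t * unit_seq n k)"

lemma spike_in_hedgehog_set: "t \<in> {0..1} \<Longrightarrow> spike n t \<in> hedgehog_set"
  by (auto simp: hedgehog_set_def)

lemma topspace_hedgehog: "topspace hedgehog = hedgehog_set"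
  using hedgehog_set_subset_l2 by (auto simp: hedgehog_def)

lemma l2_dist_spike: "l2_dist (spike n s) (spike n t) = \<bar>s - t\<bar>"
proof -
  have "(\<Sum>\<^sub>\<infinity>k. (spike n s k - spike n t k)\<^sup>2) = (\<Sum>\<^sub>\<infinity>k\<in>{n}. (spike n s k - spike n t k)\<^sup>2)"
    by (rule infsum_cong_neutral) (auto simp: unit_seq_def)
  then show ?thesis
    by (simp add: l2_dist_def l2_norm_def unit_seq_def)
qed

lemma abs_diff_le_l2_dist: "x \<in> l2 \<Longrightarrow> y \<in> l2 \<Longrightarrow> \<bar>x n - y n\<bar> \<le> l2_dist x y"
  using L2_set_le_l2_norm[OF l2_diff, of x y "{n}"] by (simp add: l2_dist_def L2_set_def)

lemma continuous_map_spike: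
  assumes "0 \<le> e" "e \<le> 1"
  shows "continuous_map (top_of_set {0..1}) hedgehog (\<lambda>t. spike n (e * t))"
  unfolding hedgehog_def continuous_map_in_subtopology
proof
  have mem: "spike n (e * t) \<in> hedgehog_set" if "t \<in> {0..1}" for t
    using assms that by (intro spike_in_hedgehog_set) (auto simp: mult_le_one)
  then show "(\<lambda>t. spike n (e * t)) \<in> topspace (top_of_set {0..1}) \<rightarrow> hedgehog_set"
    by auto
  show "continuous_map (top_of_set {0..1}) l2.mtopology (\<lambda>t. spike n (e * t))"
    unfolding l2.continuous_map_to_metric
  proof (intro ballI allI impI)
    fix t r :: real assume t: "t \<in> topspace (top_of_set {0..1})" and r: "0 < r"
    have "l2_dist (spike n (e * t)) (spike n (e * s)) < r" if "s \<in> ball t r" for s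
    proof -
      have "l2_dist (spike n (e * t)) (spike n (e * s)) = e * \<bar>t - s\<bar>"
        using assms by (simp add: l2_dist_spike abs_mult flip: right_diff_distrib)
      also have "\<dots> \<le> 1 * \<bar>t - s\<bar>"
        using assms by (intro mult_right_mono) auto
      finally show ?thesis
        using that by (simp add: dist_real_def)
    qed
    then show "\<exists>U. openin (top_of_set {0..1}) U \<and> t \<in> U \<and>
        (\<forall>s\<in>U. spike n (e * s) \<in> l2.mball (spike n (e * t)) r)"
      using t r mem hedgehog_set_subset_l2
      by (intro exI[of _ "{0..1} \<inter> ball t r"]) (auto simp: openin_open l2.in_mball)
  qed
qed

text \<open>The open ball \<open>B\<close> of radius \<open>e\<close> about the centre and the outer
  parts \<open>A n\<close> of the spikes cover the hedgehog. The point \<open>spike n e\<close> lies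
  in \<open>A n\<close> only, so a finite subcover cannot reach all these points.\<close>

lemma compactin_hedgehog_omits_spike:
  assumes S: "compactin hedgehog S" and e: "0 < e" "e \<le> 1"
  shows "\<exists>n. spike n e \<notin> S"
proof (rule ccontr)
  assume "\<not> ?thesis"
  then have all: "spike n e \<in> S" for n by blast
  \<comment> \<open>A threshold below \<open>e\<close> puts \<open>spike n e\<close> into
    \<open>A n\<close> and makes \<open>A n\<close> overlap \<open>B\<close>; since it is positive,
    \<open>A n\<close> meets no other spike.\<close>
  define A where "A n = {x \<in> hedgehog_set. e / 2 < x n}" for n
  define B where "B = {x \<in> hedgehog_set. l2_dist (spike 0 0) x < e}"
  have zero_l2: "spike 0 0 \<in> l2"
    using spike_in_hedgehog_set[of 0] hedgehog_set_subset_l2 by auto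
  have "openin l2.mtopology {x \<in> l2. e / 2 < x n}" for n
    unfolding l2.openin_mtopology
  proof (intro conjI allI impI)
    fix x assume x: "x \<in> {x \<in> l2. e / 2 < x n}"
    have "l2.mball x (x n - e / 2) \<subseteq> {x \<in> l2. e / 2 < x n}"
    proof
      fix y assume y: "y \<in> l2.mball x (x n - e / 2)"
      then show "y \<in> {x \<in> l2. e / 2 < x n}"
        using abs_diff_le_l2_dist[of x y n] by (auto simp: l2.in_mball)
    qed
    then show "\<exists>r>0. l2.mball x r \<subseteq> {x \<in> l2. e / 2 < x n}"
      using x by (intro exI[of _ "x n - e / 2"]) auto
  qed auto
  then have opA: "openin hedgehog (A n)" for n
    unfolding hedgehog_def openin_subtopology A_def using hedgehog_set_subset_l2
    by (intro exI[of _ "{x \<in> l2. e / 2 < x n}"]) auto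
  have opB: "openin hedgehog B"
    unfolding hedgehog_def openin_subtopology B_def using hedgehog_set_subset_l2 zero_l2
    by (intro exI[of _ "l2.mball (spike 0 0) e"]) (auto simp: l2.in_mball)
  have "x \<in> \<Union>(insert B (range A))" if x: "x \<in> hedgehog_set" for x
  proof -
    obtain m t where mt: "x = spike m t" "t \<in> {0..1}"
      using x by (auto simp: hedgehog_set_def)
    show ?thesis
    proof (cases "t < e")
      case True
      then have "l2_dist (spike 0 0) x < e"
        using mt l2_dist_spike[of 0 m t] by simp
      then show ?thesis using x by (simp add: B_def)
    next
      case False
      then have "x \<in> A m"
        using x mt e by (simp add: A_def unit_seq_def)
      then show ?thesis by blast
    qed
  qed
  then have "S \<subseteq> \<Union>(insert B (range A))"
    using compactin_subset_topspace[OF S] topspace_hedgehog by blast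
  then obtain \<F> where \<F>: "finite \<F>" "\<F> \<subseteq> insert B (range A)" "S \<subseteq> \<Union>\<F>"
    using compactinD[OF S, of "insert B (range A)"] opA opB by blast
  have memA: "spike n e \<in> A m \<longleftrightarrow> n = m" for n m
    using e spike_in_hedgehog_set[of e n] by (auto simp: A_def unit_seq_def)
  have "spike n e \<notin> B" for n
    using e l2_dist_spike[of 0 n e] by (simp add: B_def)
  moreover have "\<exists>U\<in>\<F>. spike n e \<in> U" for n
    using subsetD[OF \<F>(3) all[of n]] by (rule UnionE) blast
  ultimately have "A n \<in> \<F>" for n
    using \<F>(2) memA by (metis (no_types, lifting) insert_iff rangeE subsetD)
  then have "finite (range A)"
    by (intro finite_subset[OF _ \<F>(1)]) auto
  moreover have "inj A"
    by (metis injI memA)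
  ultimately show False
    using finite_imageD by blast
qed

section \<open>Escaping arcs from a closed hedgehog\<close>

text \<open>As \<open>C\<close> is closed, a translate of \<open>K\<close> meets it in a compact
  set, which corresponds to a compact subset of the hedgehog and so omits some
  \<open>spike n e\<close>. The initial segment of that spike, translated so that the centre goes to
  0, is the arc.\<close>

lemma closed_hedgehog_imp_escaping_arcs:
  fixes C :: "'a::{topological_group_add, t2_space} set"
  assumes "closed C" and hom: "top_of_set C homeomorphic_space hedgehog"
  shows "has_escaping_arcs TYPE('a)"
  unfolding has_escaping_arcs_def
proof (intro allI impI)
  fix U K :: "'a set"
  assume U: "open U" "0 \<in> U" and K: "compact K"
  obtain \<phi> \<psi> where \<phi>: "continuous_map (top_of_set C) hedgehog \<phi>"
    and \<psi>: "continuous_map hedgehog (top_of_set C) \<psi>"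
    and \<phi>\<psi>: "\<And>y. y \<in> hedgehog_set \<Longrightarrow> \<phi> (\<psi> y) = y"
    using hom by (auto simp: homeomorphic_space_def homeomorphic_maps_def topspace_hedgehog)
  define z where "z = spike 0 0"
  have z: "z \<in> hedgehog_set"
    unfolding z_def by (intro spike_in_hedgehog_set) auto
  have zn: "spike n 0 = z" for n
    by (simp add: z_def)
  have \<psi>': "continuous_map hedgehog euclidean \<psi>"
    using \<psi> by (simp add: continuous_map_in_subtopology)
  have "open ((\<lambda>a. a - \<psi> z) -` U)"
    using U by (intro open_vimage) (auto intro!: continuous_intros)
  then have "openin hedgehog {x \<in> topspace hedgehog. \<psi> x \<in> (\<lambda>a. a - \<psi> z) -` U}"
    by (intro openin_continuous_map_preimage[OF \<psi>']) auto
  then obtain T where T: "openin l2.mtopology T"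
      "{x \<in> hedgehog_set. \<psi> x - \<psi> z \<in> U} = T \<inter> hedgehog_set"
    by (auto simp: topspace_hedgehog) (auto simp: hedgehog_def openin_subtopology)
  have "z \<in> T"
    using T(2) z U(2) by (metis (mono_tags, lifting) IntE diff_self mem_Collect_eq)
  then obtain r where r: "r > 0" "l2.mball z r \<subseteq> T"
    using T(1) by (auto simp: l2.openin_mtopology)
  \<comment> \<open>Below \<open>r\<close>, so that the segment stays in the ball inside
    \<open>T\<close>; at most 1, so that it stays on the spike.\<close>
  define e where "e = min (r / 2) 1"
  have e: "0 < e" "e \<le> 1" "e < r"
    using r(1) by (auto simp: e_def)
  \<comment> \<open>Adding \<open>\<psi> z\<close> undoes the translation in \<open>g\<close> below:
    \<open>g 1\<close> in \<open>K\<close> would put \<open>\<psi> (spike n e)\<close> into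
    \<open>L\<close>.\<close>
  define L where "L = (\<lambda>a. a + \<psi> z) ` K \<inter> C"
  have "compact L"
    unfolding L_def using assms(1) K
    by (intro compact_Int_closed compact_continuous_image) (auto intro!: continuous_intros)
  then have "compactin hedgehog (\<phi> ` L)"
    by (intro image_compactin[OF _ \<phi>]) (auto simp: compactin_subtopology L_def)
  then obtain n where n: "spike n e \<notin> \<phi> ` L"
    using compactin_hedgehog_omits_spike e by blast
  define g where "g t = \<psi> (spike n (e * t)) - \<psi> z" for t
  have mem: "spike n (e * t) \<in> hedgehog_set" if "t \<in> {0..1}" for t
    using e that by (intro spike_in_hedgehog_set) (auto simp: mult_le_one)
  have "continuous_map (top_of_set {0..1}) euclidean (\<psi> \<circ> (\<lambda>t. spike n (e * t)))"
    using e by (intro continuous_map_compose[OF continuous_map_spike \<psi>']) auto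
  then have "continuous_on {0..1} g"
    unfolding g_def by (intro continuous_on_diff continuous_on_const) (simp add: o_def)
  moreover have "g 0 = 0"
    using zn by (simp add: g_def)
  moreover have "g t \<in> U" if t: "t \<in> {0..1}" for t
  proof -
    have "l2_dist z (spike n (e * t)) = e * t"
      using l2_dist_spike[of 0 n "e * t"] zn[of n] e t by simp
    also have "\<dots> \<le> e"
      using e t by (simp add: mult_left_le)
    finally have "spike n (e * t) \<in> T"
      using r(2) z mem[OF t] hedgehog_set_subset_l2 e by (auto simp: l2.in_mball subset_eq)
    then show ?thesis
      using T(2) mem[OF t] unfolding g_def by blast
  qed
  moreover have "g 1 \<notin> K"
  proof
    assume "g 1 \<in> K"
    moreover have "\<psi> (spike n e) = g 1 + \<psi> z"
      by (simp add: g_def)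
    moreover have h: "spike n e \<in> hedgehog_set"
      using e by (intro spike_in_hedgehog_set) auto
    moreover have "\<psi> (spike n e) \<in> C"
      using continuous_map_image_subset_topspace[OF \<psi>] h topspace_hedgehog by auto
    ultimately have "\<psi> (spike n e) \<in> L"
      by (auto simp: L_def)
    then show False
      using n \<phi>\<psi>[OF h] by (metis imageI)
  qed
  ultimately show "\<exists>g. continuous_on {0..1::real} g \<and> g 0 = 0 \<and> g ` {0..1} \<subseteq> U \<and> g 1 \<notin> K"
    by blast
qed

section \<open>Contradiction with bounded dimension\<close>

text \<open>A strict natural bound on the supremum holds for each dimension; as that is an infimum,
  strictness yields an actual integer bound \<open>m\<close> below \<open>N\<close>.\<close>

lemma compactly_finite_dimensional_bound:
  assumes "compactly_finite_dimensional X"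
  obtains N :: nat where "\<And>K. compactin X K \<Longrightarrow> \<exists>m. covering_dim_le (subtopology X K) m \<and> m < int N"
proof -
  obtain N :: nat where N: "(SUP K \<in> {K. compactin X K}. covering_dim (subtopology X K)) < ereal (real N)"
    using assms by (auto simp: compactly_finite_dimensional_def less_PInf_Ex_of_nat)
  show ?thesis
  proof (rule that)
    fix K assume "compactin X K"
    then have "covering_dim (subtopology X K) < ereal (real N)"
      by (intro le_less_trans[OF _ N] SUP_upper) auto
    then show "\<exists>m. covering_dim_le (subtopology X K) m \<and> m < int N"
      unfolding covering_dim_def Inf_less_iff by auto
  qed
qed

theorem corollary1p4:
  assumes "compactly_finite_dimensional (euclidean :: 'a::{topological_group_add, t2_space} topology)"
  shows "\<not> (\<exists>C :: 'a set. closed C \<and> top_of_set C homeomorphic_space hedgehog)"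
proof
  assume "\<exists>C :: 'a set. closed C \<and> top_of_set C homeomorphic_space hedgehog"
  then have arcs: "has_escaping_arcs TYPE('a)"
    using closed_hedgehog_imp_escaping_arcs by blast
  obtain N :: nat where
    N: "\<And>K :: 'a set. compact K \<Longrightarrow> \<exists>m. covering_dim_le (top_of_set K) m \<and> m < int N"
    using compactly_finite_dimensional_bound[OF assms] by auto
  \<comment> \<open>With \<open>N\<close> separated directions the image has dimension at least
    \<open>N\<close>, the strict upper bound for compact sets.\<close>
  obtain f :: "(nat \<Rightarrow> real) \<Rightarrow> 'a" where f: "continuous_on cube f" "separates_faces N f"
    using escaping_arcs_imp_separated_cubes[OF arcs] by blast
  obtain m where "covering_dim_le (top_of_set (f ` cube)) m" "m < int N"
    using N compact_continuous_image[OF f(1) compact_cube] by blast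
  then show False
    using covering_dim_le_cube_image[OF f] by fastforce
qed

end
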